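(* For a commutative semigroup $X$ the following conditions are equivalent: (1) the semigroup $N_2^\bullet(X)$ is commutative; (2) $N_2^\bullet(X)$ is supercommutative; (3) $\{xu,yv\}\cap\{xv,yu,xw,yw\}\ne\emptyset$ for any points $x,y,u,v,w\in X$; (4) $\mathcal A*\mathcal B=\mathcal A\circledast\mathcal B$ for any upfamilies $\mathcal A\in N_2^\bullet(X)$ and $\mathcal B\in N_2(X)$; (5) $\mathcal A*\mathcal B=\mathcal B*\mathcal A$ for any $\mathcal A\in\varphi^\bullet(X)$ and $\mathcal B\in N_2^\bullet(X)$; (6) either $X$ is a square-linear semigroup whose digraph $(X,\Delta)$ contains no bipartite cycles, or else $X$ contains a 2-element subgroup $H$ such that $x^3\in H$ and $xy=x^3y^3$ for all points $x,y\in X$.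
   Context: An upfamily on a nonempty set $X$ is a nonempty family $\mathcal F$ of nonempty subsets of $X$ such that $F\in\mathcal F$ and $F\subset E\subset X$ imply $E\in\mathcal F$; $\upsilon(X)$ is the set of all upfamilies on $X$. A family $\mathcal G$ of nonempty subsets of $X$ generates the upfamily $\langle G:G\in\mathcal G\rangle=\{E\subset X:\exists G\in\mathcal G,\ G\subset E\}$. An upfamily $\mathcal F$ is linked if $A\cap B\ne\emptyset$ for all $A,B\in\mathcal F$, and is a filter if $A\cap B\in\mathcal F$ for all $A,B\in\mathcal F$. It is finitely supported if it equals $\langle F_1,\dots,F_n\rangle$ for some (finitely many, at least one) nonempty finite sets $F_i\subset X$. $N_2(X)$ is the set of linked upfamilies, $N_2^\bullet(X)$ the set of finitely supported linked upfamilies, $\varphi^\bullet(X)$ the set of finitely supported filters. If $X$ is a semigroup, put for $\mathcal A,\mathcal B\in\upsilon(X)$: $\mathcal A*\mathcal B=\langle\bigcup_{a\in A}aB_a: A\in\mathcal A,\ (B_a)_{a\in A}\in\mathcal B^A\rangle$ and $\mathcal A\circledast\mathcal B=\langle AB:A\in\mathcal A,\ B\in\mathcal B\rangle$, where $AB=\{ab:a\in A,b\in B\}$. The operation $*$ is associative and $N_2(X)$, $N_2^\bullet(X)$ are subsemigroups of $(\upsilon(X),* )$. A subsemigroup $S$ of $(\upsilon(X),* )$ is commutative if $\mathcal A*\mathcal B=\mathcal B*\mathcal A$ for all $\mathcal A,\mathcal B\in S$, and supercommutative if $\mathcal A*\mathcal B=\mathcal A\circledast\mathcal B=\mathcal B\circledast\mathcal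 A=\mathcal B*\mathcal A$ for all $\mathcal A,\mathcal B\in S$. A semigroup $X$ is square-linear if $xy\in\{x^2,y^2\}$ for all $x,y\in X$; it is endowed with the digraph structure $\Delta=\{(x,y)\in X\times X:xy=x^2\}$. A cycle of length $n\ge 1$ in $(X,\Delta)$ is a sequence $x_0,\dots,x_n$ of vertices with $x_0=x_n$ and $(x_i,x_{i+1})\in\Delta$ for all $i<n$. It is bipartite if $n$ is even and $(x_i,x_j)\notin\Delta\cap\Delta^{-1}$ for all $i,j\in\{1,\dots,n\}$ with $i-j$ odd, where $\Delta^{-1}=\{(y,x):(x,y)\in\Delta\}$. *)

theory Defs
  imports "HOL-Library.Set_Algebras" "HOL-Algebra.Group"
begin

text \<open>
  The semigroup \<open>X\<close> is the whole (nonempty) type \<open>'a\<close>, with multiplication \<open>*\<close>. A family of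
  subsets of \<open>X\<close> has type \<open>'a set set\<close>. From \<open>Set_Algebras\<close>, \<open>a *o B\<close> is the translate
  \<open>{ab | b \<in> B}\<close> and \<open>A * B\<close> on sets is \<open>{ab | a \<in> A, b \<in> B}\<close>.
\<close>

definition upfamily :: "'a set set \<Rightarrow> bool" where
  "upfamily \<F> \<longleftrightarrow> \<F> \<noteq> {} \<and> {} \<notin> \<F> \<and> (\<forall>F E. F \<in> \<F> \<longrightarrow> F \<subseteq> E \<longrightarrow> E \<in> \<F>)"

definition generated :: "'a set set \<Rightarrow> 'a set set" where
  "generated \<G> = {E. \<exists>G\<in>\<G>. G \<subseteq> E}"

definition linked :: "'a set set \<Rightarrow> bool" where
  "linked \<F> \<longleftrightarrow> (\<forall>A\<in>\<F>. \<forall>B\<in>\<F>. A \<inter> B \<noteq> {})"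

definition inter_closed :: "'a set set \<Rightarrow> bool" where
  "inter_closed \<F> \<longleftrightarrow> (\<forall>A\<in>\<F>. \<forall>B\<in>\<F>. A \<inter> B \<in> \<F>)"

definition finitely_supported :: "'a set set \<Rightarrow> bool" where
  "finitely_supported \<F> \<longleftrightarrow>
     (\<exists>\<G>. finite \<G> \<and> \<G> \<noteq> {} \<and> (\<forall>G\<in>\<G>. finite G \<and> G \<noteq> {}) \<and> \<F> = generated \<G>)"

definition N2 :: "'a set set set" where
  "N2 = {\<F>. upfamily \<F> \<and> linked \<F>}"

definition N2_fin :: "'a set set set" where
  "N2_fin = {\<F> \<in> N2. finitely_supported \<F>}"

text \<open>An upfamily closed under binary intersections is a filter; \<open>phi_fin\<close> is
  \<open>\<phi>\<^sup>\<bullet>(X)\<close>, and \<open>N2_fin\<close> is \<open>N\<^sub>2\<^sup>\<bullet>(X)\<close>.\<close>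

definition phi_fin :: "'a set set set" where
  "phi_fin = {\<F>. upfamily \<F> \<and> inter_closed \<F> \<and> finitely_supported \<F>}"

definition up_star :: "'a::semigroup_mult set set \<Rightarrow> 'a set set \<Rightarrow> 'a set set"
    (infixl \<open>\<star>\<close> 70) where
  "\<A> \<star> \<B> = generated {\<Union>a\<in>A. a *o B a | A B. A \<in> \<A> \<and> (\<forall>a\<in>A. B a \<in> \<B>)}"

definition up_circ :: "'a::semigroup_mult set set \<Rightarrow> 'a set set \<Rightarrow> 'a set set"
    (infixl \<open>\<circledast>\<close> 70) where
  "\<A> \<circledast> \<B> = generated {A * B | A B. A \<in> \<A> \<and> B \<in> \<B>}"

text \<open>The next two notions are meant for sets of upfamilies that are closed under \<open>\<star>\<close>, such as
  \<open>N2_fin\<close>.\<close>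

definition up_commutative :: "'a::semigroup_mult set set set \<Rightarrow> bool" where
  "up_commutative S \<longleftrightarrow> (\<forall>\<A>\<in>S. \<forall>\<B>\<in>S. \<A> \<star> \<B> = \<B> \<star> \<A>)"

definition up_supercommutative :: "'a::semigroup_mult set set set \<Rightarrow> bool" where
  "up_supercommutative S \<longleftrightarrow>
     (\<forall>\<A>\<in>S. \<forall>\<B>\<in>S. \<A> \<star> \<B> = \<A> \<circledast> \<B> \<and> \<A> \<circledast> \<B> = \<B> \<circledast> \<A> \<and> \<B> \<circledast> \<A> = \<B> \<star> \<A>)"

text \<open>Powers are written as products since a semigroup need not have a unit.\<close>

definition square_linear :: "'a::semigroup_mult itself \<Rightarrow> bool" where
  "square_linear _ \<longleftrightarrow> (\<forall>x y :: 'a. x * y \<in> {x * x, y * y})"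

definition square_digraph :: "('a::semigroup_mult \<times> 'a) set" where
  "square_digraph = {(x, y). x * y = x * x}"

text \<open>The vertices of a cycle of length \<open>n\<close> are \<open>x 0, \<dots>, x n\<close>; other values of \<open>x\<close> are
  irrelevant. Vertices may repeat.\<close>

definition digraph_cycle :: "('a \<times> 'a) set \<Rightarrow> nat \<Rightarrow> (nat \<Rightarrow> 'a) \<Rightarrow> bool" where
  "digraph_cycle D n x \<longleftrightarrow> n \<ge> 1 \<and> x 0 = x n \<and> (\<forall>i<n. (x i, x (Suc i)) \<in> D)"

definition bipartite_cycle :: "('a \<times> 'a) set \<Rightarrow> nat \<Rightarrow> (nat \<Rightarrow> 'a) \<Rightarrow> bool" where
  "bipartite_cycle D n x \<longleftrightarrow> digraph_cycle D n x \<and> even n \<and>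
     (\<forall>i\<in>{1..n}. \<forall>j\<in>{1..n}. odd (int i - int j) \<longrightarrow> (x i, x j) \<notin> D \<inter> D\<inverse>)"

text \<open>A subgroup of a semigroup is a subset that is a group under the restricted multiplication;
  its unit \<open>e\<close> need not be a unit of the semigroup.\<close>

definition semigroup_subgroup :: "'a::semigroup_mult set \<Rightarrow> bool" where
  "semigroup_subgroup H \<longleftrightarrow> (\<exists>e. Group.group \<lparr>carrier = H, mult = (*), one = e\<rparr>)"

end

(*
  The implications proved are (1) => (5) => (3) => (6) => (4) => (2) => (1).

  (5) => (3): compare the two products of <{x, y}> and <{u, v}, {u, w}, {v, w}>.

  (3) => (6): if xy is neither x^2 nor y^2, the instances of (3) at x, y force powers of x or y to
  form a 2-element group {e, p}; then (3) with three arguments in {e, p} gives zv = ezv for all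
  z, v, with ez and ev in {e, p}. If X is square-linear, a chord of a bipartite cycle splits off
  either a bipartite 4-cycle or a bipartite cycle that is shorter by 2, and a bipartite 4-cycle
  x_1 x_2 x_3 x_4 contradicts (3) with w = e, where e is the common cube of the x_i.

  (6) => (4): let C be the union of the a B_a over a finite set A. If A B_a is not contained in C
  for any a in A, choose f(a) in A and b(a) in B_a with f(a) b(a) outside C. Along a periodic orbit
  of f, the points a and b(a) alternate to form a bipartite cycle, because C contains the squares of
  one kind of points and none of the squares of the other kind.
*)

theory Submission
  imports Defs
begin

section \<open>Periodic points of self-maps of finite sets\<close>

lemma finite_self_map_periodic:
  fixes f :: "'a \<Rightarrow> 'a"
  assumes fin: "finite A" and ne: "A \<noteq> {}" and maps: "\<And>a. a \<in> A \<Longrightarrow> f a \<in> A"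
  obtains a n where "a \<in> A" "n \<ge> 1" "(f ^^ n) a = a"
proof -
  obtain a where a: "a \<in> A" using ne by blast
  have inA: "(f ^^ i) a \<in> A" for i
    by (induction i) (auto simp: a maps)
  have "finite (range (\<lambda>i. (f ^^ i) a))"
    by (rule finite_subset[OF _ fin]) (use inA in blast)
  then have "\<not> inj (\<lambda>i. (f ^^ i) a)"
    using finite_imageD infinite_UNIV_nat by blast
  then obtain k l where "k \<noteq> l" "(f ^^ k) a = (f ^^ l) a"
    unfolding inj_def by blast
  then obtain i j where ij: "i < j" "(f ^^ i) a = (f ^^ j) a"
    by (cases k l rule: linorder_cases) auto
  \<comment> \<open>The earlier of two coinciding iterates is a periodic point, with period
    \<open>j - i\<close>.\<close>
  have "(f ^^ (j - i)) ((f ^^ i) a) = (f ^^ (j - i + i)) a"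
    by (simp only: funpow_add comp_apply)
  also have "\<dots> = (f ^^ i) a" using ij by simp
  finally show thesis using that[of "(f ^^ i) a" "j - i"] ij inA by simp
qed

section \<open>Upfamilies\<close>

lemma mem_generatedI: "G \<in> \<G> \<Longrightarrow> G \<subseteq> E \<Longrightarrow> E \<in> generated \<G>"
  by (auto simp: generated_def)

lemma upfamily_generated:
  assumes "\<G> \<noteq> {}" "{} \<notin> \<G>"
  shows "upfamily (generated \<G>)"
  unfolding upfamily_def
proof (intro conjI allI impI)
  show "generated \<G> \<noteq> {}" using assms(1) mem_generatedI by blast
  show "{} \<notin> generated \<G>" using assms(2) by (auto simp: generated_def)
  show "E \<in> generated \<G>" if F: "F \<in> generated \<G>" "F \<subseteq> E" for F E
  proof -
    obtain G where "G \<in> \<G>" "G \<subseteq> F" using F by (auto simp: generated_def)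
    then show ?thesis using F(2) by (intro mem_generatedI[of G]) auto
  qed
qed

lemma linked_generated:
  assumes "\<And>F G. F \<in> \<G> \<Longrightarrow> G \<in> \<G> \<Longrightarrow> F \<inter> G \<noteq> {}"
  shows "linked (generated \<G>)"
  unfolding linked_def generated_def
proof (intro ballI)
  fix A B assume "A \<in> {E. \<exists>G\<in>\<G>. G \<subseteq> E}" "B \<in> {E. \<exists>G\<in>\<G>. G \<subseteq> E}"
  then obtain F G where "F \<in> \<G>" "F \<subseteq> A" "G \<in> \<G>" "G \<subseteq> B" by blast
  then show "A \<inter> B \<noteq> {}" using assms[of F G] by blast
qed

lemma generated_in_N2_fin:
  assumes "finite \<G>" "\<G> \<noteq> {}" "\<And>G. G \<in> \<G> \<Longrightarrow> finite G"
    and "\<And>F G. F \<in> \<G> \<Longrightarrow> G \<in> \<G> \<Longrightarrow> F \<inter> G \<noteq> {}"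
  shows "generated \<G> \<in> N2_fin"
proof -
  have ne: "G \<noteq> {}" if "G \<in> \<G>" for G using assms(4)[OF that that] by simp
  then have "finitely_supported (generated \<G>)"
    unfolding finitely_supported_def using assms(1-3) by blast
  moreover have "upfamily (generated \<G>)" using ne assms(2) by (intro upfamily_generated) auto
  ultimately show ?thesis
    using linked_generated assms(4) unfolding N2_fin_def N2_def by blast
qed

lemma principal_in_phi_fin:
  assumes "finite G" "G \<noteq> {}"
  shows "generated {G} \<in> phi_fin"
proof -
  have "finitely_supported (generated {G})"
    unfolding finitely_supported_def using assms by (intro exI[of _ "{G}"]) simp
  moreover have "upfamily (generated {G})" using assms by (intro upfamily_generated) auto
  ultimately show ?thesis by (auto simp: phi_fin_def inter_closed_def generated_def)
qed

lemma phi_fin_subset_N2_fin: "phi_fin \<subseteq> N2_fin"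
proof
  fix \<F> :: "'a set set" assume F: "\<F> \<in> phi_fin"
  then have "\<forall>A\<in>\<F>. \<forall>B\<in>\<F>. A \<inter> B \<in> \<F>" "{} \<notin> \<F>"
    by (simp_all add: phi_fin_def inter_closed_def upfamily_def)
  then have "linked \<F>" unfolding linked_def by metis
  then show "\<F> \<in> N2_fin" using F by (simp add: phi_fin_def N2_fin_def N2_def)
qed

lemma finitely_supported_finite_subset:
  assumes "finitely_supported \<A>" "A \<in> \<A>"
  obtains G where "G \<in> \<A>" "G \<subseteq> A" "finite G" "G \<noteq> {}"
  using assms unfolding finitely_supported_def generated_def by blast

section \<open>Comparing the two products of upfamilies\<close>

lemma mem_up_star_iff:
  "E \<in> \<A> \<star> \<B> \<longleftrightarrow>
     (\<exists>A B. A \<in> \<A> \<and> (\<forall>a\<in>A. B a \<in> \<B>) \<and> (\<Union>a\<in>A. a *o B a) \<subseteq> E)"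
proof
  assume "E \<in> \<A> \<star> \<B>"
  then obtain D where "D \<in> {\<Union>a\<in>A. a *o B a | A B. A \<in> \<A> \<and> (\<forall>a\<in>A. B a \<in> \<B>)}" "D \<subseteq> E"
    unfolding up_star_def generated_def by auto
  then show "\<exists>A B. A \<in> \<A> \<and> (\<forall>a\<in>A. B a \<in> \<B>) \<and> (\<Union>a\<in>A. a *o B a) \<subseteq> E"
    by (elim CollectE exE conjE, intro exI conjI) simp_all
next
  assume "\<exists>A B. A \<in> \<A> \<and> (\<forall>a\<in>A. B a \<in> \<B>) \<and> (\<Union>a\<in>A. a *o B a) \<subseteq> E"
  then obtain A B where AB: "A \<in> \<A>" "\<forall>a\<in>A. B a \<in> \<B>" and sub: "(\<Union>a\<in>A. a *o B a) \<subseteq> E"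
    by auto
  have "(\<Union>a\<in>A. a *o B a) \<in> {\<Union>a\<in>A. a *o B a | A B. A \<in> \<A> \<and> (\<forall>a\<in>A. B a \<in> \<B>)}"
    using AB by (intro CollectI exI[of _ A] exI[of _ B]) simp
  then show "E \<in> \<A> \<star> \<B>"
    using sub unfolding up_star_def by (rule mem_generatedI)
qed

lemma up_circ_subset_up_star: "\<A> \<circledast> \<B> \<subseteq> \<A> \<star> \<B>"
proof
  fix E assume "E \<in> \<A> \<circledast> \<B>"
  then obtain A B where AB: "A \<in> \<A>" "B \<in> \<B>" "A * B \<subseteq> E"
    unfolding up_circ_def generated_def by blast
  have "(\<Union>a\<in>A. a *o B) = A * B" by (auto simp: elt_set_times_def set_times_def)
  then show "E \<in> \<A> \<star> \<B>" using AB
    unfolding mem_up_star_iff by (intro exI[of _ A] exI[of _ "\<lambda>_. B"]) simp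
qed

text \<open>Constant families \<open>B\<close> already give one inclusion, so for equality it
  suffices to find a product set inside each generator of the star product.\<close>

lemma up_star_eq_up_circI:
  assumes "\<And>A B. A \<in> \<A> \<Longrightarrow> \<forall>a\<in>A. B a \<in> \<B> \<Longrightarrow>
    \<exists>A'\<in>\<A>. \<exists>B'\<in>\<B>. A' * B' \<subseteq> (\<Union>a\<in>A. a *o B a)"
  shows "\<A> \<star> \<B> = \<A> \<circledast> \<B>"
proof (rule antisym[OF _ up_circ_subset_up_star], rule subsetI)
  fix E assume "E \<in> \<A> \<star> \<B>"
  then obtain A B where AB: "A \<in> \<A>" "\<forall>a\<in>A. B a \<in> \<B>" "(\<Union>a\<in>A. a *o B a) \<subseteq> E"
    unfolding mem_up_star_iff by auto
  obtain A' B' where "A' \<in> \<A>" "B' \<in> \<B>" "A' * B' \<subseteq> (\<Union>a\<in>A. a *o B a)"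
    using assms[OF AB(1,2)] by blast
  with AB(3) have "A' \<in> \<A>" "B' \<in> \<B>" "A' * B' \<subseteq> E" by auto
  then show "E \<in> \<A> \<circledast> \<B>" unfolding up_circ_def generated_def by blast
qed

lemma up_circ_commute:
  fixes \<A> \<B> :: "'a::ab_semigroup_mult set set"
  shows "\<A> \<circledast> \<B> = \<B> \<circledast> \<A>"
  unfolding up_circ_def by (metis (no_types, opaque_lifting) mult.commute)

section \<open>The five-point condition (3), forced by condition (5)\<close>

definition five_point :: "'a::ab_semigroup_mult itself \<Rightarrow> bool" where
  "five_point _ \<longleftrightarrow>
     (\<forall>x y u v w :: 'a. {x * u, y * v} \<inter> {x * v, y * u, x * w, y * w} \<noteq> {})"

lemma five_pointD:
  fixes x y u v w :: "'a::ab_semigroup_mult"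
  assumes "five_point TYPE('a)"
  shows "x * u \<in> {x * v, y * u, x * w, y * w} \<or> y * v \<in> {x * v, y * u, x * w, y * w}"
  using assms unfolding five_point_def by blast

lemma five_point_if_phi_fin_commutes:
  assumes "\<forall>\<A>\<in>phi_fin. \<forall>\<B>\<in>N2_fin. \<A> \<star> \<B> = \<B> \<star> (\<A> :: 'a::ab_semigroup_mult set set)"
  shows "five_point TYPE('a)"
  unfolding five_point_def
proof (intro allI)
  fix x y u v w :: 'a
  show "{x * u, y * v} \<inter> {x * v, y * u, x * w, y * w} \<noteq> {}"
  proof (cases "x = y")
    case False
    let ?A = "generated {{x, y}}" and ?B = "generated {{u, v}, {u, w}, {v, w}}"
    let ?C = "{x * v, y * u, x * w, y * w}"
    \<comment> \<open>This choice leaves out exactly the products \<open>x * u\<close> and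
      \<open>y * v\<close>, so the union is the right-hand set of (3).\<close>
    define B where "B a = (if a = x then {v, w} else {u, w})" for a
    have "(\<Union>a\<in>{x, y}. a *o B a) = ?C"
      using False by (auto simp: B_def elt_set_times_def)
    moreover have "{x, y} \<in> ?A" "\<forall>a\<in>{x, y}. B a \<in> ?B"
      by (auto simp: B_def generated_def)
    ultimately have "?C \<in> ?A \<star> ?B"
      unfolding mem_up_star_iff by (intro exI[of _ "{x, y}"] exI[of _ B]) simp
    moreover have "?A \<in> phi_fin" by (rule principal_in_phi_fin) auto
    moreover have "?B \<in> N2_fin" by (rule generated_in_N2_fin) auto
    ultimately have "?C \<in> ?B \<star> ?A" using assms by blast
    then obtain D A where DA: "D \<in> ?B" "\<forall>b\<in>D. A b \<in> ?A" "(\<Union>b\<in>D. b *o A b) \<subseteq> ?C"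
      unfolding mem_up_star_iff by auto
    have "b * x \<in> ?C \<and> b * y \<in> ?C" if "b \<in> D" for b
      using that DA(2,3) unfolding generated_def elt_set_times_def by blast
    \<comment> \<open>Each two-element generator of \<open>?B\<close> meets {u, v}. As every
      \<open>A b\<close> contains {x, y}, one of u, v has both of its translates in
      \<open>?C\<close>.\<close>
    moreover have "u \<in> D \<or> v \<in> D" using DA(1) by (auto simp: generated_def)
    ultimately have "u * x \<in> ?C \<or> v * y \<in> ?C" by blast
    then show ?thesis by (simp only: mult.commute[of _ x] mult.commute[of _ y]) blast
  qed simp
qed

section \<open>Consequences of the five-point condition\<close>

text \<open>By (3), every w satisfies xy = xw or xy = yw, and some element of {x^2, y^2} lies in
  {xw, yw}. Putting w = xy and w = y^2 yields y^3 = xy and y^4 = x^2 or y^4 = y^2. The powers of y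
  are then 2-periodic from y^2 on, or from y^3 on because y^5 = yx^2 = x(xy) = y^3; two consecutive
  powers form the group.\<close>

lemma two_group_from_non_square_linear:
  fixes x y :: "'a::ab_semigroup_mult"
  assumes five: "five_point TYPE('a)" and nsq: "x * y \<noteq> x * x" "x * y \<noteq> y * y"
    and xp: "x * (x * y) = x * y"
  obtains e p :: 'a where "e * e = e" "e * p = p" "p * p = e" "p \<noteq> e"
proof -
  have p: "x * y = x * w \<or> x * y = y * w" for w
    using five_pointD[OF five, of x y x y w] nsq by (auto simp: mult.commute)
  have s: "{x * x, y * y} \<inter> {x * w, y * w} \<noteq> {}" for w
    using five_pointD[OF five, of x x y y w] nsq by (auto simp: mult.commute)
  have yp: "y * (x * y) = x * x \<or> y * (x * y) = y * y"
    using s[of "x * y"] xp nsq by auto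
  have y3: "y * (y * y) = x * y"
    using p[of "y * y"] yp nsq by (auto simp: mult.assoc mult.left_commute mult.commute)
  have y4: "y * (y * (y * y)) = x * x \<or> y * (y * (y * y)) = y * y"
    using yp y3 by simp
  have ne: "y * (y * y) \<noteq> y * y" "y * (y * y) \<noteq> x * x" using y3 nsq by simp_all
  from y4 show thesis
  proof
    assume h: "y * (y * (y * y)) = y * y"
    show thesis
      by (rule that[of "y * y" "y * (y * y)"]) (use h ne in \<open>simp_all add: mult.assoc\<close>)
  next
    assume h: "y * (y * (y * y)) = x * x"
    have "y * (y * (y * (y * y))) = y * (x * x)" by (simp only: h)
    also have "\<dots> = x * (x * y)" by (simp add: ac_simps)
    finally have y5: "y * (y * (y * (y * y))) = y * (y * y)" using xp y3 by simp
    have "y * (y * y) \<noteq> y * (y * (y * y))" using ne h by simp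
    then show thesis
      by (intro that[of "y * (y * (y * y))" "y * (y * y)"])
         (use y5 in \<open>simp_all add: mult.assoc\<close>)
  qed
qed

lemma products_in_two_group:
  fixes e p :: "'a::ab_semigroup_mult"
  assumes five: "five_point TYPE('a)" and grp: "e * e = e" "e * p = p" "p * p = e" "p \<noteq> e"
  shows "e * z \<in> {e, p}" and "z * v = e * z * (e * v)"
proof -
  \<comment> \<open>The instance gives p = ez or p = pz, and in the latter case ez = p(pz) = pp =
    e.\<close>
  have in_H: "e * z = e \<or> e * z = p" for z
    using five_pointD[OF five, of e p e p z] grp
    by (auto simp: mult.commute) (metis mult.assoc mult.commute)+
  show "e * z \<in> {e, p}" using in_H by simp
  define a b where ab_def: "a = e * z" "b = e * v"
  have ab: "a * b = e \<or> a * b = p"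
    using in_H[of z] in_H[of v] grp by (auto simp: ab_def mult.commute)
  have "a * b = (e * e) * (z * v)" by (simp add: ab_def ac_simps)
  then have ezv: "a * b = e * (z * v)" using grp by simp
  then have zb: "z * b = a * b" and av: "a * v = a * b"
    by (simp_all add: ab_def ac_simps)
  \<comment> \<open>In the instance of (3) used next, both left-hand products equal ab. On the
    right, three products equal p(ab), which differs from ab because multiplication by p swaps e and
    p. Only zv remains to equal ab.\<close>
  have "(p * a) * (p * b) = (p * p) * (a * b)" by (simp add: ac_simps)
  also have "\<dots> = a * b" using ab grp by auto
  finally have "a * b \<in> {z * (p * b), (p * a) * b, z * v, (p * a) * v}"
    using five_pointD[OF five, of z b "p * b" "p * a" v] zb by simp
  moreover have "z * (p * b) = p * (a * b)" using zb by (metis mult.left_commute)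
  moreover have "(p * a) * v = p * (a * b)" using av by (simp add: mult.assoc)
  moreover have "a * b \<noteq> p * (a * b)" using ab grp by (auto simp: mult.commute)
  ultimately show "z * v = e * z * (e * v)" by (auto simp: mult.assoc simp flip: ab_def)
qed

lemma two_group_case:
  fixes e p :: "'a::ab_semigroup_mult"
  assumes five: "five_point TYPE('a)" and grp: "e * e = e" "e * p = p" "p * p = e" "p \<noteq> e"
  shows "\<exists>H :: 'a set. semigroup_subgroup H \<and> card H = 2 \<and>
           (\<forall>x :: 'a. x * x * x \<in> H) \<and>
           (\<forall>x y :: 'a. x * y = (x * x * x) * (y * y * y))"
proof (intro exI conjI allI)
  note H = products_in_two_group[OF five grp]
  have pe: "p * e = p" using grp by (simp add: mult.commute)
  \<comment> \<open>All squares collapse to e, so cubing is the map z -> ez into {e, p}.\<close>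
  have cube: "z * z * z = e * z" for z
  proof -
    have "z * z = e * z * (e * z)" by (rule H(2))
    also have "\<dots> = e" using H(1)[of z] grp by auto
    finally show ?thesis by simp
  qed
  show "semigroup_subgroup {e, p}"
    unfolding semigroup_subgroup_def
    by (rule exI[of _ e], rule groupI) (use grp pe in \<open>auto simp: mult.assoc\<close>)
  show "card {e, p} = 2" using grp by auto
  show "x * x * x \<in> {e, p}" for x using cube H(1) by simp
  show "x * y = x * x * x * (y * y * y)" for x y :: 'a
    using H(2)[of x y] by (simp only: cube)
qed

lemma square_linear_or_two_group:
  assumes five: "five_point TYPE('a::ab_semigroup_mult)"
  shows "square_linear TYPE('a) \<or>
    (\<exists>H :: 'a set. semigroup_subgroup H \<and> card H = 2 \<and>
           (\<forall>x :: 'a. x * x * x \<in> H) \<and>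
           (\<forall>x y :: 'a. x * y = (x * x * x) * (y * y * y)))"
proof (rule disjCI)
  assume no_H: "\<not> (\<exists>H :: 'a set. semigroup_subgroup H \<and> card H = 2 \<and>
           (\<forall>x :: 'a. x * x * x \<in> H) \<and>
           (\<forall>x y :: 'a. x * y = (x * x * x) * (y * y * y)))"
  have absorb: False if "x * y \<noteq> x * x" "x * y \<noteq> y * y" "x * (x * y) = x * y" for x y :: 'a
    using two_group_from_non_square_linear[OF five that] two_group_case[OF five] no_H by metis
  show "square_linear TYPE('a)"
    unfolding square_linear_def
  proof (intro allI, rule ccontr)
    fix x y :: 'a
    assume "x * y \<notin> {x * x, y * y}"
    then have nsq: "x * y \<noteq> x * x" "x * y \<noteq> y * y" by auto
    \<comment> \<open>Taking w = xy in (3) produces the absorption hypothesis, up to exchanging x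
      and y.\<close>
    have "x * (x * y) = x * y \<or> y * (x * y) = x * y"
      using five_pointD[OF five, of x y x y "x * y"] nsq by (auto simp: mult.commute)
    then show False using absorb[of x y] absorb[of y x] nsq by (auto simp: mult.commute)
  qed
qed

section \<open>Square-linear semigroups\<close>

context
  assumes sl: "square_linear TYPE('a::ab_semigroup_mult)"
begin

lemma square_linear_cases: "x * y = x * x \<or> x * y = y * (y :: 'a)"
  using sl unfolding square_linear_def by blast

lemma square_linear_fourth_power: "x * (x * (x * x)) = x * (x * (x :: 'a))"
  using square_linear_cases[of x "x * x"] by (auto simp: mult.assoc)

text \<open>This turns the bipartite condition into one on squares: vertices of opposite parity have
  different squares.\<close>

lemma symmetric_edge_iff:
  "(x, y) \<in> square_digraph \<inter> square_digraph\<inverse> \<longleftrightarrow> x * x = y * (y :: 'a)"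
  using square_linear_cases[of x y] by (auto simp: square_digraph_def mult.commute)

text \<open>Cubes are idempotent, and cubing turns an edge into absorption: (xy)^3 = x^6 =
  x^3.\<close>

lemma cube_edge:
  assumes "x * y = x * (x :: 'a)"
  shows "(x * (x * x)) * (y * (y * y)) = x * (x * x)"
proof -
  have "(x * (x * x)) * (y * (y * y)) = (x * y) * ((x * y) * (x * y))" by (simp add: ac_simps)
  also have "\<dots> = x * (x * x)"
    by (simp add: assms mult.assoc square_linear_fourth_power)
  finally show ?thesis .
qed

text \<open>Read \<open>a * b = a\<close> as a <= b, as in a semilattice. Associativity makes this
  transitive and commutativity makes it antisymmetric, so a closed chain collapses.\<close>

lemma cyclic_absorption:
  fixes a b c d :: 'a
  assumes "a * b = a" "b * c = b" "c * d = c" "d * a = d"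
  shows "a = d"
proof -
  have "a = a * c" using assms(1,2) by (metis mult.assoc)
  also have "\<dots> = d * a" using assms(3) calculation by (metis mult.assoc mult.commute)
  finally show ?thesis using assms(4) by simp
qed

lemma no_square_alternating_four_cycle:
  fixes x y z t :: 'a
  assumes five: "five_point TYPE('a)"
    and cyc: "x * y = x * x" "y * z = y * y" "z * t = z * z" "t * x = t * t"
    and alt: "{x * x, z * z} \<inter> {y * y, t * t} = {}"
  shows False
proof -
  let ?c = "\<lambda>a :: 'a. a * (a * a)"
  have c: "?c x * ?c y = ?c x" "?c y * ?c z = ?c y" "?c z * ?c t = ?c z" "?c t * ?c x = ?c t"
    using cyc by (simp_all add: cube_edge)
  have "?c x = ?c t" "?c y = ?c t" "?c z = ?c t"
    using cyclic_absorption[OF c] cyclic_absorption[OF c(2-4,1)] cyclic_absorption[OF c(3,4,1,2)]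
    by simp_all
  then obtain e where e: "?c x = e" "?c y = e" "?c z = e" "?c t = e" by metis
  have we: "x * e = e" "y * e = e" "z * e = e" "t * e = e"
    using square_linear_fourth_power[of x] square_linear_fourth_power[of y]
      square_linear_fourth_power[of z] square_linear_fourth_power[of t] by (simp_all add: e)
  \<comment> \<open>The first instance puts the common cube e into {x^2, z^2}, the second, along the
    rotated cycle, into {y^2, t^2}; these sets are disjoint.\<close>
  show False
    using five_pointD[OF five, of x y t z e] five_pointD[OF five, of y z x t e] cyc alt we
    by (auto simp: mult.commute)
qed

lemma bipartite_cycle_iff:
  "bipartite_cycle (square_digraph :: ('a \<times> 'a) set) n x \<longleftrightarrow>
     n \<ge> 1 \<and> even n \<and> x 0 = x n \<and> (\<forall>i<n. x i * x (Suc i) = x i * x i) \<and>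
     (\<forall>i\<in>{1..n}. \<forall>j\<in>{1..n}. odd i \<noteq> odd j \<longrightarrow> x i * x i \<noteq> x j * x j)"
proof -
  have "odd (int i - int j) \<longleftrightarrow> odd i \<noteq> odd j" for i j by simp
  then show ?thesis
    unfolding bipartite_cycle_def digraph_cycle_def symmetric_edge_iff
    by (auto simp: square_digraph_def)
qed

text \<open>Strong induction on the length. For n > 4, square-linearity orients the chord between
  \<open>x 0\<close> and \<open>x 3\<close>: one direction bypasses two vertices, the other closes a
  4-cycle.\<close>

lemma no_bipartite_cycle:
  assumes five: "five_point TYPE('a)"
  shows "\<not> bipartite_cycle (square_digraph :: ('a \<times> 'a) set) n x"
proof (induction n arbitrary: x rule: less_induct)
  case (less n)
  show ?case
  proof
    assume "bipartite_cycle square_digraph n x"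
    then have n: "n \<ge> 1" "even n" and closed: "x 0 = x n"
      and edge: "\<And>i. i < n \<Longrightarrow> x i * x (Suc i) = x i * x i"
      and alt: "\<And>i j. \<lbrakk>i \<in> {1..n}; j \<in> {1..n}; odd i \<noteq> odd j\<rbrakk> \<Longrightarrow> x i * x i \<noteq> x j * x j"
      unfolding bipartite_cycle_iff by auto
    show False
    proof (cases "n = 2")
      case True
      have "x 0 * x 1 = x 0 * x 0" "x 1 * x 2 = x 1 * x 1"
        using edge[of 0] edge[of 1] True by (simp_all add: numeral_2_eq_2)
      then show False using alt[of 1 2] closed True by (simp add: mult.commute)
    next
      case False
      then have n4: "n \<ge> 4" using n by (auto elim!: evenE)
      have path: "x 0 * x 1 = x 0 * x 0" "x 1 * x 2 = x 1 * x 1" "x 2 * x 3 = x 2 * x 2"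
        using edge[of 0] edge[of 1] edge[of 2] n4 by (simp_all add: eval_nat_numeral)
      show False
      proof (cases "n > 4 \<and> x 0 * x 3 = x 0 * x 0")
        case True
        \<comment> \<open>The chord replaces the detour through \<open>x 1\<close> and
          \<open>x 2\<close>; shifting the later indices by 2 preserves parity.\<close>
        define y where "y i = (if i = 0 then x 0 else x (i + 2))" for i
        have "bipartite_cycle square_digraph (n - 2) y"
          unfolding bipartite_cycle_iff
        proof (intro conjI ballI allI impI)
          have "n - 2 + 2 = n" using n4 by simp
          then show "y 0 = y (n - 2)" using n4 closed by (simp add: y_def)
          show "y i * y (Suc i) = y i * y i" if "i < n - 2" for i
            using True edge[of "i + 2"] that by (cases "i = 0") (auto simp: y_def eval_nat_numeral)
          show "y i * y i \<noteq> y j * y j"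
            if "i \<in> {1..n - 2}" "j \<in> {1..n - 2}" "odd i \<noteq> odd j" for i j
          proof -
            have "i + 2 \<in> {1..n}" "j + 2 \<in> {1..n}" "odd (i + 2) \<noteq> odd (j + 2)"
              using that n4 by auto
            from alt[OF this] show ?thesis using that by (simp add: y_def)
          qed
        qed (use n n4 in auto)
        then show False using less.IH[of "n - 2"] n4 by simp
      next
        case no_chord: False
        have rev_edge: "x 3 * x 0 = x 3 * x 3"
        proof (cases "n = 4")
          case True
          then show ?thesis using edge[of 3] closed by simp
        next
          case False
          then show ?thesis
            using no_chord n4 square_linear_cases[of "x 3" "x 0"]
            by (auto simp: mult.commute)
        qed
        \<comment> \<open>Parities are compared only on indices 1 to n, so vertex 0 enters as the
          even index n.\<close>
        have "{x 0 * x 0, x 2 * x 2} \<inter> {x 1 * x 1, x 3 * x 3} = {}"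
          using alt[of n 1] alt[of n 3] alt[of 2 1] alt[of 2 3] n n4 closed by auto
        then show False
          using no_square_alternating_four_cycle[OF five path rev_edge] by blast
      qed
    qed
  qed
qed

section \<open>Product sets inside finite unions of translates\<close>

lemma finite_union_contains_product:
  fixes B :: "'a \<Rightarrow> 'a set"
  assumes no_cycle: "\<nexists>n x. bipartite_cycle (square_digraph :: ('a \<times> 'a) set) n x"
    and A: "finite A" "A \<noteq> {}"
  shows "\<exists>a\<in>A. A * B a \<subseteq> (\<Union>a\<in>A. a *o B a)"
proof (rule ccontr)
  define C where "C = (\<Union>a\<in>A. a *o B a)"
  assume "\<not> ?thesis"
  then have "\<forall>a\<in>A. \<exists>c b. c \<in> A \<and> b \<in> B a \<and> c * b \<notin> C"
    unfolding set_times_def C_def by blast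
  then obtain f g where fg: "\<And>a. a \<in> A \<Longrightarrow> f a \<in> A \<and> g a \<in> B a \<and> f a * g a \<notin> C"
    by metis
  obtain a n where an: "a \<in> A" "n \<ge> 1" "(f ^^ n) a = a"
    using finite_self_map_periodic[OF A, of f] fg by blast
  define c where "c i = (f ^^ i) a" for i
  define b where "b i = g (c i)" for i
  have cA: "c i \<in> A" for i
    by (induction i) (auto simp: c_def an fg)
  have inC: "c i * b i \<in> C" for i
    using fg[OF cA, of i] cA[of i] by (auto simp: b_def C_def elt_set_times_def)
  have notC: "c (Suc i) * b i \<notin> C" for i
    using fg[OF cA, of i] by (simp add: b_def c_def)
  have period: "c (n * k) = a" for k
    by (induction k) (simp_all add: c_def funpow_add an)
  \<comment> \<open>If c_i^2 is outside C, then c_i b_i in C forces b_i^2 into C, and c_{i+1} b_i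
    outside C forces c_{i+1}^2 outside C.\<close>
  have fwd: "c (i + k) * c (i + k) \<notin> C" if "c i * c i \<notin> C" for i k
  proof (induction k)
    case (Suc k)
    then have "b (i + k) * b (i + k) \<in> C"
      using inC[of "i + k"] square_linear_cases[of "c (i + k)" "b (i + k)"] by metis
    then show ?case
      using notC[of "i + k"] square_linear_cases[of "c (Suc (i + k))" "b (i + k)"]
      by (metis add_Suc_right)
  qed (simp add: that)
  \<comment> \<open>Being outside C propagates forward along the orbit, and the orbit returns to a
    at time \<open>n * i\<close>, which is at least i. Hence membership is the same for all
    c_i^2.\<close>
  have const: "c i * c i \<in> C \<longleftrightarrow> a * a \<in> C" for i
  proof
    assume "c i * c i \<in> C"
    then show "a * a \<in> C" using fwd[of 0 i] by (auto simp: c_def)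
  next
    assume "a * a \<in> C"
    moreover have "i + (n * i - i) = n * i" using an(2) by simp
    ultimately show "c i * c i \<in> C" using fwd[of i "n * i - i"] period[of i] by metis
  qed
  have b_iff: "b i * b i \<in> C \<longleftrightarrow> a * a \<notin> C" for i
    using const[of i] const[of "Suc i"] inC[of i] notC[of i]
      square_linear_cases[of "c i" "b i"] square_linear_cases[of "c (Suc i)" "b i"] by metis
  \<comment> \<open>The sequence c_0, b_0, c_1, b_1, ... closes up after 2n steps.\<close>
  define x where "x i = (if even i then c (i div 2) else b (i div 2))" for i
  have x_iff: "x i * x i \<in> C \<longleftrightarrow> (a * a \<in> C \<longleftrightarrow> even i)" for i
    using const b_iff by (auto simp: x_def)
  \<comment> \<open>Even i gives c_k b_k, odd i gives b_k c_{k+1}. Squares and consecutive products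
    thus both alternate between C and its complement, which decides which of the two squares each
    product equals.\<close>
  have x_edge: "x i * x (Suc i) \<in> C \<longleftrightarrow> even i" for i
    using inC[of "i div 2"] notC[of "i div 2"] by (auto simp: x_def mult.commute elim!: evenE oddE)
  have closed: "x 0 = x (2 * n)" using an by (simp add: x_def c_def)
  have alt: "x i * x i \<noteq> x j * x j" if "odd i \<noteq> odd j" for i j
    using x_iff[of i] x_iff[of j] that by metis
  \<comment> \<open>The cycle runs in one direction or the other, according to which squares lie in the union.\<close>
  show False
  proof (cases "a * a \<in> C")
    case True
    have "x i * x (Suc i) = x i * x i" for i
      using x_iff[of i] x_iff[of "Suc i"] x_edge[of i] True
        square_linear_cases[of "x i" "x (Suc i)"] by (metis even_Suc)
    then have "bipartite_cycle square_digraph (2 * n) x"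
      unfolding bipartite_cycle_iff using an closed alt by auto
    then show False using no_cycle by blast
  next
    case False
    have rev_edge: "x (Suc i) * x i = x (Suc i) * x (Suc i)" for i
      using x_iff[of i] x_iff[of "Suc i"] x_edge[of i] False
        square_linear_cases[of "x i" "x (Suc i)"] by (metis even_Suc mult.commute)
    have "bipartite_cycle square_digraph (2 * n) (\<lambda>i. x (2 * n - i))"
      unfolding bipartite_cycle_iff
    proof (intro conjI ballI allI impI)
      show "x (2 * n - i) * x (2 * n - Suc i) = x (2 * n - i) * x (2 * n - i)"
        if "i < 2 * n" for i
        using rev_edge[of "2 * n - Suc i"] that by (simp add: Suc_diff_Suc)
      show "x (2 * n - i) * x (2 * n - i) \<noteq> x (2 * n - j) * x (2 * n - j)"
        if "i \<in> {1..2 * n}" "j \<in> {1..2 * n}" "odd i \<noteq> odd j" for i j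
        using that by (intro alt) auto
    qed (use an closed in auto)
    then show False using no_cycle by blast
  qed
qed

end

section \<open>The equivalence\<close>

text \<open>All products lie in the two-element set H. A union equal to H contains every product
  set. Otherwise it has at most one point: by linkedness \<open>B a\<close> and \<open>B a'\<close>
  share some w, so aw = a'w, and cancelling in H gives a^3 = a'^3, whence ab = a'b for all
  b.\<close>

lemma two_group_star_eq_circ:
  fixes \<A> \<B> :: "'a::ab_semigroup_mult set set"
  assumes H: "card H = 2" "\<And>x :: 'a. x * x * x \<in> H" "semigroup_subgroup H"
    and cubes: "\<And>x y :: 'a. x * y = (x * x * x) * (y * y * y)"
    and \<A>: "upfamily \<A>" and \<B>: "upfamily \<B>" "linked \<B>"
  shows "\<A> \<star> \<B> = \<A> \<circledast> \<B>"
proof (rule up_star_eq_up_circI)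
  fix A B assume A: "A \<in> \<A>" and B: "\<forall>a\<in>A. B a \<in> \<B>"
  let ?C = "\<Union>a\<in>A. a *o B a"
  obtain e where "Group.group \<lparr>carrier = H, mult = (*), one = e\<rparr>"
    using H(3) unfolding semigroup_subgroup_def by blast
  then interpret grp: Group.group "\<lparr>carrier = H, mult = (*), one = e\<rparr>" .
  have prod_H: "x * y \<in> H" for x y :: 'a
    using grp.m_closed[of "x * x * x" "y * y * y"] H(2) cubes[of x y] by simp
  have cancel: "x * x * x = y * y * y" if "x * w = y * w" for x y w :: 'a
    using grp.right_cancel[of "w * w * w" "x * x * x" "y * y * y"] H(2) that
      cubes[of x w] cubes[of y w] by simp
  have A_ne: "A \<noteq> {}" using A \<A> by (auto simp: upfamily_def)
  have sub_H: "?C \<subseteq> H" using prod_H by (auto simp: elt_set_times_def)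
  have fin: "finite H" using H(1) by (auto intro: card_ge_0_finite)
  obtain a where a: "a \<in> A" using A_ne by blast
  have "A * B a \<subseteq> ?C"
  proof (cases "?C = H")
    case True
    then show ?thesis using prod_H by (auto simp: set_times_def)
  next
    case False
    then have "card ?C < 2" using sub_H fin H(1) psubset_card_mono by (metis psubsetI)
    then have "card ?C \<le> Suc 0" by simp
    then have one: "s = t" if "s \<in> ?C" "t \<in> ?C" for s t
      using that card_le_Suc0_iff_eq[OF finite_subset[OF sub_H fin]] by blast
    have mem: "a' * b \<in> ?C" if "a' \<in> A" "b \<in> B a'" for a' b
      using that by (auto simp: elt_set_times_def)
    have "a' * b \<in> ?C" if a': "a' \<in> A" and b: "b \<in> B a" for a' b
    proof -
      obtain w where "w \<in> B a" "w \<in> B a'"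
        using \<B>(2) B a a' unfolding linked_def by blast
      then have "a * w = a' * w" using one mem a a' by blast
      then have "a * b = a' * b" using cancel cubes by metis
      then show ?thesis using mem[OF a b] by simp
    qed
    then show ?thesis by (auto simp: set_times_def)
  qed
  then show "\<exists>A'\<in>\<A>. \<exists>B'\<in>\<B>. A' * B' \<subseteq> ?C" using A B a by blast
qed

text \<open>Finite support lets A shrink to a finite member G of the upfamily; a product set inside
  the union over G also lies in the union over A.\<close>

lemma square_linear_star_eq_circ:
  fixes \<A> \<B> :: "'a::ab_semigroup_mult set set"
  assumes sl: "square_linear TYPE('a)"
    and no_cycle: "\<nexists>n x. bipartite_cycle (square_digraph :: ('a \<times> 'a) set) n x"
    and \<A>: "finitely_supported \<A>"
  shows "\<A> \<star> \<B> = \<A> \<circledast> \<B>"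
proof (rule up_star_eq_up_circI)
  fix A B assume A: "A \<in> \<A>" and B: "\<forall>a\<in>A. B a \<in> \<B>"
  obtain G where G: "G \<in> \<A>" "G \<subseteq> A" "finite G" "G \<noteq> {}"
    using finitely_supported_finite_subset[OF \<A> A] .
  obtain a where a: "a \<in> G" "G * B a \<subseteq> (\<Union>a\<in>G. a *o B a)"
    using finite_union_contains_product[OF sl no_cycle G(3,4)] by blast
  have "G * B a \<subseteq> (\<Union>a\<in>A. a *o B a)" using a(2) G(2) by blast
  then show "\<exists>A'\<in>\<A>. \<exists>B'\<in>\<B>. A' * B' \<subseteq> (\<Union>a\<in>A. a *o B a)" using B G a by blast
qed

theorem theorem8p1:
  shows
    "(up_commutative (N2_fin :: 'a::ab_semigroup_mult set set set) \<longleftrightarrow>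
        up_supercommutative (N2_fin :: 'a set set set)) \<and>
     (up_commutative (N2_fin :: 'a set set set) \<longleftrightarrow>
        (\<forall>x y u v w :: 'a. {x * u, y * v} \<inter> {x * v, y * u, x * w, y * w} \<noteq> {})) \<and>
     (up_commutative (N2_fin :: 'a set set set) \<longleftrightarrow>
        (\<forall>\<A> \<in> (N2_fin :: 'a set set set). \<forall>\<B> \<in> N2. \<A> \<star> \<B> = \<A> \<circledast> \<B>)) \<and>
     (up_commutative (N2_fin :: 'a set set set) \<longleftrightarrow>
        (\<forall>\<A> \<in> (phi_fin :: 'a set set set). \<forall>\<B> \<in> N2_fin. \<A> \<star> \<B> = \<B> \<star> \<A>)) \<and>
     (up_commutative (N2_fin :: 'a set set set) \<longleftrightarrow>
        (square_linear TYPE('a) \<and>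
           (\<nexists>n x. bipartite_cycle (square_digraph :: ('a \<times> 'a) set) n x)) \<or>
        (\<exists>H :: 'a set. semigroup_subgroup H \<and> card H = 2 \<and>
           (\<forall>x :: 'a. x * x * x \<in> H) \<and>
           (\<forall>x y :: 'a. x * y = (x * x * x) * (y * y * y))))"
  (is "(?c1 \<longleftrightarrow> ?c2) \<and> (_ \<longleftrightarrow> ?c3) \<and> (_ \<longleftrightarrow> ?c4) \<and> (_ \<longleftrightarrow> ?c5) \<and> (_ \<longleftrightarrow> ?c6)")
proof -
  have "?c5" if "?c1"
    using that phi_fin_subset_N2_fin unfolding up_commutative_def by blast
  moreover have "?c3" if "?c5"
    using five_point_if_phi_fin_commutes[OF that] unfolding five_point_def .
  moreover have "?c6" if "?c3"
  proof -
    have "five_point TYPE('a)" using that unfolding five_point_def .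
    then show ?thesis using square_linear_or_two_group no_bipartite_cycle by blast
  qed
  moreover have "?c4" if "?c6"
  proof (intro ballI)
    fix \<A> \<B> :: "'a set set" assume "\<A> \<in> N2_fin" "\<B> \<in> N2"
    then have AB: "upfamily \<A>" "finitely_supported \<A>" "upfamily \<B>" "linked \<B>"
      by (simp_all add: N2_fin_def N2_def)
    from that show "\<A> \<star> \<B> = \<A> \<circledast> \<B>"
    proof (elim disjE exE conjE)
      assume "square_linear TYPE('a)" "\<nexists>n x. bipartite_cycle (square_digraph :: ('a \<times> 'a) set) n x"
      then show ?thesis using square_linear_star_eq_circ AB(2) by blast
    next
      fix H :: "'a set"
      assume H: "semigroup_subgroup H" "card H = 2" "\<forall>x. x * x * x \<in> H"
        "\<forall>x y :: 'a. x * y = (x * x * x) * (y * y * y)"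
      show ?thesis
        by (rule two_group_star_eq_circ[OF H(2) H(3)[rule_format] H(1) H(4)[rule_format] AB(1,3,4)])
    qed
  qed
  \<comment> \<open>Since \<open>N2_fin\<close> lies in \<open>N2\<close>, condition (4) applies
    with the factors in either order, and \<open>up_circ\<close> is commutative because X
    is.\<close>
  moreover have "?c2" if "?c4"
    using that unfolding up_supercommutative_def N2_fin_def
    by (auto simp: up_circ_commute)
  moreover have "?c1" if "?c2"
    using that unfolding up_supercommutative_def up_commutative_def by metis
  ultimately show ?thesis by argo
qed

end
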